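(* For every $n\geq 1$, the completed configuration space $\widehat{\mathrm{Emb}}(\Gamma_n)$ of $n$ oriented lines in $\mathbb{R}^3$ is homotopy equivalent to the completed space $\widehat{\mathcal E}_n$ of $n$ oriented lines through the origin.
   Context: Oriented lines: an oriented line $\ell$ in $\mathbb{R}^3$ is identified with the pair $(\mathbf v,\mathbf x)$, where $\mathbf v\in S^2$ is its unit direction vector and $\mathbf x$ is the point of $\ell$ nearest the origin. Thus the space of oriented lines is $\mathcal L=\{(\mathbf v,\mathbf x)\in S^2\times\mathbb{R}^3:\ \mathbf x\cdot\mathbf v=0\}$, with the metric inherited from $\mathbb{R}^3\times\mathbb{R}^3$. $\mathrm{Emb}(\Gamma_n)\subseteq\mathcal L^{\times n}$ is the subspace of $n$-tuples $(\ell_1,\dots,\ell_n)$ of pairwise disjoint oriented lines. The path metric on it is $d_{\mathrm{path}}(P,P')=\min\{\delta'(P,P'),1\}$, where $\delta'(P,P')$ is the infimum of the lengths of rectifiable paths from $P$ to $P'$ inside $\mathrm{Emb}(\Gamma_n)$ ($\infty$ if there is none). $\widehat{\mathrm{Emb}}(\Gamma_n)$ is the metric completion of $(\mathrm{Emb}(\Gamma_n),d_{\mathrm{path}})$. The inclusion $\mathrm{Emb}(\Gamma_n)\hookrightarrow\mathcal L^{\times n}$ extends to a continuous map $\hat\pi:\widehat{\mathrm{Emb}}(\Gamma_n)\to\mathcal L^{\times n}$. Let $\mathcal L^{\times n}_{\mathbf 0}\cong(S^2)^n$ be the subspace of $\mathcal L^{\times n}$ of $n$-tuples of lines all passing through the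 origin (all $\mathbf x_j=\mathbf 0$), and let $\widehat{\mathcal E}_n=\hat\pi^{-1}(\mathcal L^{\times n}_{\mathbf 0})\subseteq\widehat{\mathrm{Emb}}(\Gamma_n)$. *)

theory Defs
  imports "HOL-Analysis.Analysis"
begin

section \<open>Length of curves and the induced path metric\<close>

definition curve_length :: "(real \<Rightarrow> 'a::metric_space) \<Rightarrow> ennreal" where
  "curve_length g =
     (SUP (m, t) \<in> {(m :: nat, t :: nat \<Rightarrow> real). mono_on {..m} t \<and> t 0 = 0 \<and> t m = 1}.
        ennreal (\<Sum>i<m. dist (g (t i)) (g (t (Suc i)))))"

definition rectifiable_path :: "(real \<Rightarrow> 'a::metric_space) \<Rightarrow> bool" where
  "rectifiable_path g \<longleftrightarrow> path g \<and> curve_length g < \<infinity>"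

text \<open>In \<^typ>\<open>ennreal\<close> the infimum of the empty set is \<open>\<infinity>\<close>, the value required when there is
  no rectifiable path.\<close>

definition length_dist :: "'a::metric_space set \<Rightarrow> 'a \<Rightarrow> 'a \<Rightarrow> ennreal" where
  "length_dist S P Q =
     (INF g \<in> {g. rectifiable_path g \<and> path_image g \<subseteq> S \<and> pathstart g = P \<and> pathfinish g = Q}.
        curve_length g)"

definition path_dist :: "'a::metric_space set \<Rightarrow> 'a \<Rightarrow> 'a \<Rightarrow> real" where
  "path_dist S P Q = enn2real (min (length_dist S P Q) 1)"

lemma curve_length_upper:
  assumes "mono_on {..m} t" "t 0 = 0" "t m = 1"
  shows "ennreal (\<Sum>i<m. dist (g (t i)) (g (t (Suc i)))) \<le> curve_length g"
  unfolding curve_length_def by (rule SUP_upper2[of "(m, t)"]) (use assms in auto)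

lemma curve_length_least:
  assumes "\<And>m t. \<lbrakk>mono_on {..m} t; t 0 = 0; t m = 1\<rbrakk>
             \<Longrightarrow> ennreal (\<Sum>i<m. dist (g (t i)) (g (t (Suc i)))) \<le> B"
  shows "curve_length g \<le> B"
  unfolding curve_length_def by (rule SUP_least) (use assms in auto)

lemma dist_le_curve_length: "ennreal (dist (pathstart g) (pathfinish g)) \<le> curve_length g"
  using curve_length_upper[of 1 real g]
  by (simp add: mono_on_def pathstart_def pathfinish_def)

lemma curve_length_const: "curve_length (\<lambda>_. c) = 0"
proof -
  have "curve_length (\<lambda>_. c) \<le> 0"
    by (rule curve_length_least) simp
  then show ?thesis by simp
qed

lemma curve_length_reversepath_le: "curve_length (reversepath g) \<le> curve_length g"
proof (rule curve_length_least)
  fix m :: nat and t :: "nat \<Rightarrow> real"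
  assume t: "mono_on {..m} t" "t 0 = 0" "t m = 1"
  define s where "s i = 1 - t (m - i)" for i
  have "mono_on {..m} s"
    using t(1) by (auto simp: mono_on_def s_def)
  moreover have "s 0 = 0" "s m = 1"
    using t by (auto simp: s_def)
  ultimately have "ennreal (\<Sum>i<m. dist (g (s i)) (g (s (Suc i)))) \<le> curve_length g"
    by (rule curve_length_upper)
  moreover have "(\<Sum>i<m. dist (g (s i)) (g (s (Suc i))))
      = (\<Sum>i<m. dist (reversepath g (t i)) (reversepath g (t (Suc i))))"
  proof -
    have "(\<Sum>i<m. dist (g (s i)) (g (s (Suc i))))
        = (\<Sum>i<m. dist (g (s (m - Suc i))) (g (s (Suc (m - Suc i)))))"
      by (rule sum.nat_diff_reindex[symmetric])
    also have "\<dots> = (\<Sum>i<m. dist (reversepath g (t i)) (reversepath g (t (Suc i))))"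
      by (rule sum.cong)
         (auto simp: s_def reversepath_def dist_commute Suc_diff_Suc)
    finally show ?thesis .
  qed
  ultimately show "ennreal (\<Sum>i<m. dist (reversepath g (t i)) (reversepath g (t (Suc i))))
      \<le> curve_length g"
    by simp
qed

lemma curve_length_joinpaths_le:
  assumes fin: "pathfinish g = pathstart h"
  shows "curve_length (g +++ h) \<le> curve_length g + curve_length h"
proof (rule curve_length_least)
  fix m :: nat and t :: "nat \<Rightarrow> real"
  assume t: "mono_on {..m} t" "t 0 = 0" "t m = 1"
  let ?f = "g +++ h"
  let ?D = "\<lambda>i. dist (?f (t i)) (?f (t (Suc i)))"
  have le: "t i \<le> t j" if "i \<le> j" "j \<le> m" for i j
    using t(1) that by (auto simp: mono_on_def)
  define k where "k = (GREATEST i. i \<le> m \<and> t i \<le> 1/2)"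
  have k: "k \<le> m \<and> t k \<le> 1/2"
    unfolding k_def by (rule GreatestI_nat[where k = 0 and b = m]) (use t in auto)
  have kmax: "i \<le> k" if "i \<le> m" "t i \<le> 1/2" for i
    unfolding k_def by (rule Greatest_le_nat[where b = m]) (use that in auto)
  have "k < m" using k t(3) by (cases "k = m") auto
  have tk: "t (Suc k) > 1/2" using kmax[of "Suc k"] \<open>k < m\<close> by fastforce
  have lo: "?f (t i) = g (2 * t i)" if "i \<le> k" for i
    using le[OF that] k by (simp add: joinpaths_def)
  have hi: "?f (t i) = h (2 * t i - 1)" if "k < i" "i \<le> m" for i
    using le[of "Suc k" i] that tk by (simp add: joinpaths_def)
  define a where "a i = (if i \<le> k then 2 * t i else 1)" for i
  define b where "b i = (if i = 0 then 0 else 2 * t (k + i) - 1)" for i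
  have "mono_on {..Suc k} a"
    unfolding mono_on_def a_def using le k by (force dest: le[of _ k])
  then have A: "ennreal (\<Sum>i<Suc k. dist (g (a i)) (g (a (Suc i)))) \<le> curve_length g"
    by (rule curve_length_upper) (use t in \<open>auto simp: a_def\<close>)
  have "mono_on {..m - k} b"
  proof (rule mono_onI)
    fix r s assume "r \<in> {..m - k}" "s \<in> {..m - k}" "r \<le> s"
    then show "b r \<le> b s"
      using le[of "Suc k" "k + s"] tk le[of "k + r" "k + s"] \<open>k < m\<close> by (force simp: b_def)
  qed
  then have B: "ennreal (\<Sum>i<m - k. dist (h (b i)) (h (b (Suc i)))) \<le> curve_length h"
    by (rule curve_length_upper) (use t \<open>k < m\<close> in \<open>auto simp: b_def\<close>)
  have "(\<Sum>i<m. ?D i) = (\<Sum>i<k. ?D i) + ?D k + (\<Sum>i=Suc k..<m. ?D i)"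
  proof -
    have "{..<m} = {..<Suc k} \<union> {Suc k..<m}" using \<open>k < m\<close> by auto
    then have "(\<Sum>i<m. ?D i) = (\<Sum>i<Suc k. ?D i) + (\<Sum>i=Suc k..<m. ?D i)"
      by (simp add: sum.union_disjoint ivl_disj_int(2))
    then show ?thesis by simp
  qed
  also have "(\<Sum>i<k. ?D i) = (\<Sum>i<k. dist (g (a i)) (g (a (Suc i))))"
    by (rule sum.cong) (auto simp: lo a_def)
  also have "(\<Sum>i=Suc k..<m. ?D i) = (\<Sum>i=1..<m-k. dist (h (b i)) (h (b (Suc i))))"
  proof -
    have "(\<Sum>i=Suc k..<m. ?D i) = (\<Sum>i=1+k..<(m-k)+k. ?D i)"
      using \<open>k < m\<close> by simp
    also have "\<dots> = (\<Sum>i=1..<m-k. ?D (i + k))"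
      by (rule sum.shift_bounds_nat_ivl)
    also have "\<dots> = (\<Sum>i=1..<m-k. dist (h (b i)) (h (b (Suc i))))"
      by (rule sum.cong) (auto simp: hi b_def add.commute)
    finally show ?thesis .
  qed
  also have "?D k \<le> dist (g (a k)) (g (a (Suc k))) + dist (h (b 0)) (h (b 1))"
  proof -
    have "?D k = dist (g (a k)) (h (b 1))"
      using lo[of k] hi[of "Suc k"] \<open>k < m\<close> by (simp add: a_def b_def)
    moreover have "g (a (Suc k)) = h (b 0)"
      using fin by (simp add: a_def b_def pathfinish_def pathstart_def)
    ultimately show ?thesis by (metis dist_triangle)
  qed
  finally have "(\<Sum>i<m. ?D i) \<le> (\<Sum>i<Suc k. dist (g (a i)) (g (a (Suc i))))
      + (dist (h (b 0)) (h (b 1)) + (\<Sum>i=1..<m-k. dist (h (b i)) (h (b (Suc i)))))"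
    by simp
  also have "dist (h (b 0)) (h (b 1)) + (\<Sum>i=1..<m-k. dist (h (b i)) (h (b (Suc i))))
      = (\<Sum>i<m-k. dist (h (b i)) (h (b (Suc i))))"
    using \<open>k < m\<close> by (simp add: lessThan_atLeast0 sum.atLeast_Suc_lessThan)
  finally have "ennreal (\<Sum>i<m. ?D i) \<le> ennreal ((\<Sum>i<Suc k. dist (g (a i)) (g (a (Suc i))))
      + (\<Sum>i<m-k. dist (h (b i)) (h (b (Suc i)))))"
    by (rule ennreal_leI)
  also have "\<dots> = ennreal (\<Sum>i<Suc k. dist (g (a i)) (g (a (Suc i))))
      + ennreal (\<Sum>i<m-k. dist (h (b i)) (h (b (Suc i))))"
    by (intro ennreal_plus sum_nonneg) auto
  also have "\<dots> \<le> curve_length g + curve_length h"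
    by (rule add_mono[OF A B])
  finally show "ennreal (\<Sum>i<m. ?D i) \<le> curve_length g + curve_length h" .
qed

lemma dist_le_length_dist: "ennreal (dist P Q) \<le> length_dist S P Q"
  unfolding length_dist_def by (rule INF_greatest) (use dist_le_curve_length in auto)

lemma length_dist_refl: "P \<in> S \<Longrightarrow> length_dist S P P = 0"
proof -
  assume "P \<in> S"
  then have "length_dist S P P \<le> curve_length (\<lambda>_. P)"
    unfolding length_dist_def
    by (intro INF_lower)
       (auto simp: rectifiable_path_def curve_length_const path_def path_image_def
         pathstart_def pathfinish_def)
  then show ?thesis by (simp add: curve_length_const)
qed

lemma length_dist_commute_le: "length_dist S P Q \<le> length_dist S Q P"
proof -
  have "length_dist S P Q \<le> curve_length g"
    if "rectifiable_path g" "path_image g \<subseteq> S" "pathstart g = Q" "pathfinish g = P" for g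
  proof -
    have "length_dist S P Q \<le> curve_length (reversepath g)"
      unfolding length_dist_def
      using that le_less_trans[OF curve_length_reversepath_le]
      by (intro INF_lower) (auto simp: rectifiable_path_def)
    then show ?thesis using curve_length_reversepath_le order_trans by blast
  qed
  then show ?thesis
    unfolding length_dist_def[of S Q P] by (intro INF_greatest) auto
qed

lemma length_dist_triangle: "length_dist S P R \<le> length_dist S P Q + length_dist S Q R"
proof -
  let ?A = "\<lambda>P Q. {g. rectifiable_path g \<and> path_image g \<subseteq> S \<and> pathstart g = P \<and> pathfinish g = Q}"
  have *: "length_dist S P R \<le> curve_length g + curve_length h"
    if "g \<in> ?A P Q" "h \<in> ?A Q R" for g h
  proof -
    have fin: "pathfinish g = pathstart h" using that by auto
    have "curve_length (g +++ h) < \<infinity>"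
      using that le_less_trans[OF curve_length_joinpaths_le[OF fin]]
      by (simp add: rectifiable_path_def)
    then have "length_dist S P R \<le> curve_length (g +++ h)"
      unfolding length_dist_def using that fin
      by (intro INF_lower) (auto simp: rectifiable_path_def path_image_join)
    then show ?thesis using curve_length_joinpaths_le[OF fin] by (rule order_trans)
  qed
  show ?thesis
  proof (rule ennreal_le_epsilon)
    fix e :: real
    assume fin: "length_dist S P Q + length_dist S Q R < top" and "0 < e"
    then have e: "e/2 > 0" and ne: "length_dist S P Q \<noteq> \<infinity>" "length_dist S Q R \<noteq> \<infinity>"
      by auto
    obtain g where g: "g \<in> ?A P Q" "curve_length g < length_dist S P Q + e/2"
      using INF_approx_ennreal[OF e length_dist_def ne(1)] by blast
    obtain h where h: "h \<in> ?A Q R" "curve_length h < length_dist S Q R + e/2"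
      using INF_approx_ennreal[OF e length_dist_def ne(2)] by blast
    have "length_dist S P R \<le> curve_length g + curve_length h"
      by (rule *[OF g(1) h(1)])
    also have "\<dots> \<le> (length_dist S P Q + e/2) + (length_dist S Q R + e/2)"
      using g(2) h(2) by (intro add_mono less_imp_le)
    also have "\<dots> = length_dist S P Q + length_dist S Q R + (ennreal (e/2) + ennreal (e/2))"
      by (simp add: ac_simps)
    also have "ennreal (e/2) + ennreal (e/2) = ennreal e"
      using \<open>0 < e\<close> by (simp flip: ennreal_plus)
    finally show "length_dist S P R \<le> length_dist S P Q + length_dist S Q R + ennreal e" .
  qed
qed

lemma ennreal_path_dist: "ennreal (path_dist S P Q) = min (length_dist S P Q) 1"
  unfolding path_dist_def by (rule ennreal_enn2real) (simp add: min_less_iff_disj)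

lemma dist_le_path_dist: "min (dist P Q) 1 \<le> path_dist S P Q"
proof -
  have "ennreal (min (dist P Q) 1) = min (ennreal (dist P Q)) 1"
    by (auto simp: min_def ennreal_le_1)
  also have "\<dots> \<le> ennreal (path_dist S P Q)"
    unfolding ennreal_path_dist using dist_le_length_dist by (intro min.mono) auto
  finally show ?thesis
    by (metis enn2real_nonneg ennreal_le_iff path_dist_def)
qed

lemma Metric_space_path_dist: "Metric_space S (path_dist S)"
proof
  show "0 \<le> path_dist S x y" for x y
    by (simp add: path_dist_def)
  show "path_dist S x y = path_dist S y x" for x y
    unfolding path_dist_def using length_dist_commute_le by (metis order_antisym)
  show "path_dist S x y = 0 \<longleftrightarrow> x = y" if "x \<in> S" "y \<in> S" for x y
  proof
    assume "path_dist S x y = 0"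
    then show "x = y" using dist_le_path_dist[of x y S] by (auto simp: min_def split: if_splits)
  next
    assume "x = y"
    then show "path_dist S x y = 0" using that by (simp add: path_dist_def length_dist_refl)
  qed
  show "path_dist S x z \<le> path_dist S x y + path_dist S y z" for x y z
  proof -
    have "ennreal (path_dist S x z) \<le> min (length_dist S x y + length_dist S y z) 1"
      unfolding ennreal_path_dist using length_dist_triangle by (intro min.mono) auto
    also have "\<dots> \<le> min (length_dist S x y) 1 + min (length_dist S y z) 1"
    proof (cases "length_dist S x y \<le> 1 \<and> length_dist S y z \<le> 1")
      case True
      then show ?thesis by (simp add: min_def not_le less_imp_le)
    next
      case False
      then have "1 \<le> min (length_dist S x y) 1 + min (length_dist S y z) 1"
        by (metis add_increasing add_increasing2 min.absorb2 nle_le order_refl zero_le)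
      then show ?thesis by (rule min.coboundedI2)
    qed
    also have "\<dots> = ennreal (path_dist S x y + path_dist S y z)"
      by (subst ennreal_plus) (simp_all only: ennreal_path_dist, simp_all add: path_dist_def)
    finally show ?thesis
      by (subst (asm) ennreal_le_iff) (simp_all add: path_dist_def)
  qed
qed


section \<open>Metric completion by Cauchy sequences\<close>

definition Cauchy_rel :: "'a metric \<Rightarrow> ((nat \<Rightarrow> 'a) \<times> (nat \<Rightarrow> 'a)) set" where
  "Cauchy_rel m = {(\<sigma>, \<tau>). Metric_space.MCauchy (mspace m) (mdist m) \<sigma>
     \<and> Metric_space.MCauchy (mspace m) (mdist m) \<tau> \<and> (\<lambda>k. mdist m (\<sigma> k) (\<tau> k)) \<longlonglongrightarrow> 0}"

definition completion_points :: "'a metric \<Rightarrow> (nat \<Rightarrow> 'a) set set" where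
  "completion_points m = {\<sigma>. Metric_space.MCauchy (mspace m) (mdist m) \<sigma>} // Cauchy_rel m"

text \<open>The absolute value has no effect on elements of \<open>completion_points m\<close>; it is there because
  \<^const>\<open>Metric_space\<close> asks for distances to be non-negative also outside the carrier.\<close>

definition completion_dist :: "'a metric \<Rightarrow> (nat \<Rightarrow> 'a) set \<Rightarrow> (nat \<Rightarrow> 'a) set \<Rightarrow> real" where
  "completion_dist m C D = \<bar>lim (\<lambda>k. mdist m ((SOME \<sigma>. \<sigma> \<in> C) k) ((SOME \<tau>. \<tau> \<in> D) k))\<bar>"

definition completion_metric :: "'a metric \<Rightarrow> (nat \<Rightarrow> 'a) set metric" where
  "completion_metric m = metric (completion_points m, completion_dist m)"

definition completion_embed :: "'a metric \<Rightarrow> 'a \<Rightarrow> (nat \<Rightarrow> 'a) set" where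
  "completion_embed m P = Cauchy_rel m `` {\<lambda>_. P}"

lemma mdist_self: "P \<in> mspace m \<Longrightarrow> mdist m P P = 0"
  by simp

lemma Cauchy_rel_iff:
  "(\<sigma>, \<tau>) \<in> Cauchy_rel m \<longleftrightarrow> Metric_space.MCauchy (mspace m) (mdist m) \<sigma>
     \<and> Metric_space.MCauchy (mspace m) (mdist m) \<tau> \<and> (\<lambda>k. mdist m (\<sigma> k) (\<tau> k)) \<longlonglongrightarrow> 0"
  by (simp add: Cauchy_rel_def)

lemma MCauchy_in_mspace:
  "Metric_space.MCauchy (mspace m) (mdist m) \<sigma> \<Longrightarrow> \<sigma> k \<in> mspace m"
  by (auto simp: Metric_space.MCauchy_def[OF Metric_space_mspace_mdist])

lemma equiv_Cauchy_rel:
  "equiv {\<sigma>. Metric_space.MCauchy (mspace m) (mdist m) \<sigma>} (Cauchy_rel m)"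
proof (rule equivI)
  show "Cauchy_rel m \<subseteq> {\<sigma>. Metric_space.MCauchy (mspace m) (mdist m) \<sigma>}
      \<times> {\<sigma>. Metric_space.MCauchy (mspace m) (mdist m) \<sigma>}"
    by (auto simp: Cauchy_rel_iff)
  show "refl_on {\<sigma>. Metric_space.MCauchy (mspace m) (mdist m) \<sigma>} (Cauchy_rel m)"
    by (auto simp: refl_on_def Cauchy_rel_iff mdist_self[OF MCauchy_in_mspace])
  show "sym (Cauchy_rel m)"
    by (auto simp: sym_def Cauchy_rel_iff mdist_commute)
  show "trans (Cauchy_rel m)"
  proof (rule transI)
    fix \<sigma> \<tau> \<upsilon> assume st: "(\<sigma>, \<tau>) \<in> Cauchy_rel m" and tu: "(\<tau>, \<upsilon>) \<in> Cauchy_rel m"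
    have "(\<lambda>k. mdist m (\<sigma> k) (\<upsilon> k)) \<longlonglongrightarrow> 0"
    proof (rule tendsto_sandwich[OF _ _ tendsto_const])
      show "(\<lambda>k. mdist m (\<sigma> k) (\<tau> k) + mdist m (\<tau> k) (\<upsilon> k)) \<longlonglongrightarrow> 0"
        using st tu by (auto simp: Cauchy_rel_iff intro!: tendsto_add_zero)
    qed (use st tu in \<open>auto simp: Cauchy_rel_iff intro!: always_eventually mdist_triangle MCauchy_in_mspace\<close>)
    then show "(\<sigma>, \<upsilon>) \<in> Cauchy_rel m"
      using st tu by (simp add: Cauchy_rel_iff)
  qed
qed

lemma mdist_diff_le:
  assumes "x \<in> mspace m" "y \<in> mspace m" "x' \<in> mspace m" "y' \<in> mspace m"
  shows "\<bar>mdist m x y - mdist m x' y'\<bar> \<le> mdist m x x' + mdist m y y'"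
  using mdist_triangle[of x m x' y] mdist_triangle[of x' m y' y]
    mdist_triangle[of x' m x y'] mdist_triangle[of x m y y']
    mdist_commute[of m x x'] mdist_commute[of m y y'] assms
  by linarith

lemma convergent_mdist:
  assumes "Metric_space.MCauchy (mspace m) (mdist m) \<sigma>" "Metric_space.MCauchy (mspace m) (mdist m) \<tau>"
  shows "convergent (\<lambda>k. mdist m (\<sigma> k) (\<tau> k))"
proof -
  have "Cauchy (\<lambda>k. mdist m (\<sigma> k) (\<tau> k))"
  proof (rule metric_CauchyI)
    fix e :: real assume "e > 0"
    then have "e / 2 > 0" by simp
    then obtain M N where M: "\<And>j k. M \<le> j \<Longrightarrow> M \<le> k \<Longrightarrow> mdist m (\<sigma> j) (\<sigma> k) < e/2"
      and N: "\<And>j k. N \<le> j \<Longrightarrow> N \<le> k \<Longrightarrow> mdist m (\<tau> j) (\<tau> k) < e/2"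
      using assms unfolding Metric_space.MCauchy_def[OF Metric_space_mspace_mdist] by metis
    have "dist (mdist m (\<sigma> j) (\<tau> j)) (mdist m (\<sigma> k) (\<tau> k)) < e"
      if "max M N \<le> j" "max M N \<le> k" for j k
      using M[of j k] N[of j k] that
        mdist_diff_le[of "\<sigma> j" m "\<tau> j" "\<sigma> k" "\<tau> k"] MCauchy_in_mspace[OF assms(1)] MCauchy_in_mspace[OF assms(2)]
      by (simp add: dist_real_def)
    then show "\<exists>K. \<forall>j\<ge>K. \<forall>k\<ge>K. dist (mdist m (\<sigma> j) (\<tau> j)) (mdist m (\<sigma> k) (\<tau> k)) < e"
      by blast
  qed
  then show ?thesis by (simp add: Cauchy_convergent_iff)
qed

lemma Cauchy_rel_some:
  assumes "Metric_space.MCauchy (mspace m) (mdist m) \<sigma>"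
  shows "(\<sigma>, SOME \<tau>. \<tau> \<in> Cauchy_rel m `` {\<sigma>}) \<in> Cauchy_rel m"
proof -
  have "\<sigma> \<in> Cauchy_rel m `` {\<sigma>}"
    using assms by (intro equiv_class_self[OF equiv_Cauchy_rel]) simp
  then have "(SOME \<tau>. \<tau> \<in> Cauchy_rel m `` {\<sigma>}) \<in> Cauchy_rel m `` {\<sigma>}"
    unfolding some_in_eq by blast
  then show ?thesis by simp
qed

lemma tendsto_completion_dist:
  assumes "Metric_space.MCauchy (mspace m) (mdist m) \<sigma>" "Metric_space.MCauchy (mspace m) (mdist m) \<tau>"
  shows "(\<lambda>k. mdist m (\<sigma> k) (\<tau> k)) \<longlonglongrightarrow> completion_dist m (Cauchy_rel m `` {\<sigma>}) (Cauchy_rel m `` {\<tau>})"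
proof -
  define \<sigma>' where "\<sigma>' = (SOME \<upsilon>. \<upsilon> \<in> Cauchy_rel m `` {\<sigma>})"
  define \<tau>' where "\<tau>' = (SOME \<upsilon>. \<upsilon> \<in> Cauchy_rel m `` {\<tau>})"
  have s: "(\<sigma>, \<sigma>') \<in> Cauchy_rel m" and t: "(\<tau>, \<tau>') \<in> Cauchy_rel m"
    unfolding \<sigma>'_def \<tau>'_def by (intro Cauchy_rel_some assms)+
  have "convergent (\<lambda>k. mdist m (\<sigma>' k) (\<tau>' k))"
    using s t by (intro convergent_mdist) (simp_all add: Cauchy_rel_iff)
  then have "(\<lambda>k. \<bar>mdist m (\<sigma>' k) (\<tau>' k)\<bar>) \<longlonglongrightarrow> \<bar>lim (\<lambda>k. mdist m (\<sigma>' k) (\<tau>' k))\<bar>"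
    unfolding convergent_LIMSEQ_iff by (rule tendsto_rabs)
  then have lim': "(\<lambda>k. mdist m (\<sigma>' k) (\<tau>' k)) \<longlonglongrightarrow> completion_dist m (Cauchy_rel m `` {\<sigma>}) (Cauchy_rel m `` {\<tau>})"
    unfolding completion_dist_def \<sigma>'_def[symmetric] \<tau>'_def[symmetric] by simp
  have "(\<lambda>k. mdist m (\<sigma> k) (\<tau> k) - mdist m (\<sigma>' k) (\<tau>' k)) \<longlonglongrightarrow> 0"
  proof (rule Lim_null_comparison)
    show "(\<lambda>k. mdist m (\<sigma> k) (\<sigma>' k) + mdist m (\<tau> k) (\<tau>' k)) \<longlonglongrightarrow> 0"
      using s t by (auto simp: Cauchy_rel_iff intro!: tendsto_add_zero)
    show "\<forall>\<^sub>F k in sequentially. norm (mdist m (\<sigma> k) (\<tau> k) - mdist m (\<sigma>' k) (\<tau>' k))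
        \<le> mdist m (\<sigma> k) (\<sigma>' k) + mdist m (\<tau> k) (\<tau>' k)"
      using s t by (auto simp: Cauchy_rel_iff intro!: always_eventually mdist_diff_le MCauchy_in_mspace)
  qed
  from tendsto_add[OF this lim'] show ?thesis by simp
qed

lemma completion_dist_eqI:
  assumes "Metric_space.MCauchy (mspace m) (mdist m) \<sigma>" "Metric_space.MCauchy (mspace m) (mdist m) \<tau>"
    and "(\<lambda>k. mdist m (\<sigma> k) (\<tau> k)) \<longlonglongrightarrow> l"
  shows "completion_dist m (Cauchy_rel m `` {\<sigma>}) (Cauchy_rel m `` {\<tau>}) = l"
  using tendsto_completion_dist[OF assms(1,2)] assms(3) LIMSEQ_unique by blast

lemma completion_pointsE:
  assumes "C \<in> completion_points m"
  obtains \<sigma> where "Metric_space.MCauchy (mspace m) (mdist m) \<sigma>" "C = Cauchy_rel m `` {\<sigma>}"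
  using assms unfolding completion_points_def by (auto elim: quotientE)

lemma completion_pointsI:
  "Metric_space.MCauchy (mspace m) (mdist m) \<sigma> \<Longrightarrow> Cauchy_rel m `` {\<sigma>} \<in> completion_points m"
  unfolding completion_points_def by (simp add: quotientI)

lemma Metric_space_completion: "Metric_space (completion_points m) (completion_dist m)"
proof
  show "0 \<le> completion_dist m C D" for C D
    by (simp add: completion_dist_def)
  show "completion_dist m C D = completion_dist m D C" for C D
    unfolding completion_dist_def by (simp add: mdist_commute)
  show "completion_dist m C D = 0 \<longleftrightarrow> C = D"
    if CD: "C \<in> completion_points m" "D \<in> completion_points m" for C D
  proof -
    obtain \<sigma> where s: "Metric_space.MCauchy (mspace m) (mdist m) \<sigma>" "C = Cauchy_rel m `` {\<sigma>}"
      using CD(1) by (rule completion_pointsE)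
    obtain \<tau> where t: "Metric_space.MCauchy (mspace m) (mdist m) \<tau>" "D = Cauchy_rel m `` {\<tau>}"
      using CD(2) by (rule completion_pointsE)
    have "C = D \<longleftrightarrow> (\<sigma>, \<tau>) \<in> Cauchy_rel m"
      using s t by (simp add: eq_equiv_class_iff[OF equiv_Cauchy_rel])
    also have "\<dots> \<longleftrightarrow> (\<lambda>k. mdist m (\<sigma> k) (\<tau> k)) \<longlonglongrightarrow> 0"
      using s(1) t(1) by (simp add: Cauchy_rel_iff)
    also have "\<dots> \<longleftrightarrow> completion_dist m C D = 0"
      unfolding s(2) t(2)
      using tendsto_completion_dist[OF s(1) t(1)] completion_dist_eqI[OF s(1) t(1)] by metis
    finally show ?thesis by simp
  qed
  show "completion_dist m C E \<le> completion_dist m C D + completion_dist m D E"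
    if CDE: "C \<in> completion_points m" "D \<in> completion_points m" "E \<in> completion_points m" for C D E
  proof -
    obtain \<sigma> where s: "Metric_space.MCauchy (mspace m) (mdist m) \<sigma>" "C = Cauchy_rel m `` {\<sigma>}"
      using CDE(1) by (rule completion_pointsE)
    obtain \<tau> where t: "Metric_space.MCauchy (mspace m) (mdist m) \<tau>" "D = Cauchy_rel m `` {\<tau>}"
      using CDE(2) by (rule completion_pointsE)
    obtain \<upsilon> where u: "Metric_space.MCauchy (mspace m) (mdist m) \<upsilon>" "E = Cauchy_rel m `` {\<upsilon>}"
      using CDE(3) by (rule completion_pointsE)
    have "(\<lambda>k. mdist m (\<sigma> k) (\<tau> k) + mdist m (\<tau> k) (\<upsilon> k)) \<longlonglongrightarrow> completion_dist m C D + completion_dist m D E"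
      unfolding s(2) t(2) u(2) by (intro tendsto_add tendsto_completion_dist s(1) t(1) u(1))
    moreover have "(\<lambda>k. mdist m (\<sigma> k) (\<upsilon> k)) \<longlonglongrightarrow> completion_dist m C E"
      unfolding s(2) u(2) by (intro tendsto_completion_dist s(1) u(1))
    moreover have "mdist m (\<sigma> k) (\<upsilon> k) \<le> mdist m (\<sigma> k) (\<tau> k) + mdist m (\<tau> k) (\<upsilon> k)" for k
      by (intro mdist_triangle MCauchy_in_mspace s(1) t(1) u(1))
    ultimately show ?thesis
      by (meson LIMSEQ_le)
  qed
qed

lemma mspace_completion_metric [simp]: "mspace (completion_metric m) = completion_points m"
  and mdist_completion_metric [simp]: "mdist (completion_metric m) = completion_dist m"
  by (simp_all add: completion_metric_def Metric_space.mspace_metric Metric_space.mdist_metric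
      Metric_space_completion)

lemma completion_embed_in:
  "P \<in> mspace m \<Longrightarrow> completion_embed m P \<in> completion_points m"
  unfolding completion_embed_def
  by (intro completion_pointsI) (simp add: Metric_space.MCauchy_const[OF Metric_space_mspace_mdist])

lemma completion_embed_isometry:
  "\<lbrakk>P \<in> mspace m; Q \<in> mspace m\<rbrakk>
    \<Longrightarrow> completion_dist m (completion_embed m P) (completion_embed m Q) = mdist m P Q"
  unfolding completion_embed_def
  by (intro completion_dist_eqI) (simp_all add: Metric_space.MCauchy_const[OF Metric_space_mspace_mdist])

lemma completion_embed_tendsto:
  assumes "Metric_space.MCauchy (mspace m) (mdist m) \<sigma>"
  shows "(\<lambda>k. completion_dist m (completion_embed m (\<sigma> k)) (Cauchy_rel m `` {\<sigma>})) \<longlonglongrightarrow> 0"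
proof (rule LIMSEQ_I)
  fix e :: real assume "e > 0"
  then obtain N where N: "\<And>j k. N \<le> j \<Longrightarrow> N \<le> k \<Longrightarrow> mdist m (\<sigma> j) (\<sigma> k) < e/2"
    using assms unfolding Metric_space.MCauchy_def[OF Metric_space_mspace_mdist]
    by (meson half_gt_zero)
  have "norm (completion_dist m (completion_embed m (\<sigma> j)) (Cauchy_rel m `` {\<sigma>}) - 0) < e"
    if "N \<le> j" for j
  proof -
    have "(\<lambda>k. mdist m (\<sigma> j) (\<sigma> k)) \<longlonglongrightarrow> completion_dist m (completion_embed m (\<sigma> j)) (Cauchy_rel m `` {\<sigma>})"
      unfolding completion_embed_def
      using tendsto_completion_dist[of m "\<lambda>_. \<sigma> j" \<sigma>] assms MCauchy_in_mspace[OF assms]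
      by (simp add: Metric_space.MCauchy_const[OF Metric_space_mspace_mdist])
    then have "completion_dist m (completion_embed m (\<sigma> j)) (Cauchy_rel m `` {\<sigma>}) \<le> e/2"
      by (rule LIMSEQ_le_const2) (use N that in \<open>auto intro: less_imp_le\<close>)
    moreover have "0 \<le> completion_dist m (completion_embed m (\<sigma> j)) (Cauchy_rel m `` {\<sigma>})"
      by (rule Metric_space.nonneg[OF Metric_space_completion])
    ultimately show ?thesis using \<open>e > 0\<close> by simp
  qed
  then show "\<exists>N. \<forall>j\<ge>N. norm (completion_dist m (completion_embed m (\<sigma> j)) (Cauchy_rel m `` {\<sigma>}) - 0) < e"
    by blast
qed

lemma completion_embed_dense:
  "mtopology_of (completion_metric m) closure_of (completion_embed m ` mspace m)
     = mspace (completion_metric m)"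
proof -
  interpret C: Metric_space "completion_points m" "completion_dist m"
    by (rule Metric_space_completion)
  have "\<exists>P\<in>mspace m. completion_embed m P \<in> C.mball C r" if C: "C \<in> completion_points m" "r > 0" for C r
  proof -
    obtain \<sigma> where s: "Metric_space.MCauchy (mspace m) (mdist m) \<sigma>" "C = Cauchy_rel m `` {\<sigma>}"
      using C(1) by (rule completion_pointsE)
    obtain k where "completion_dist m (completion_embed m (\<sigma> k)) C < r"
      using LIMSEQ_D[OF completion_embed_tendsto[OF s(1)] \<open>r > 0\<close>] s(2) by (auto simp: abs_less_iff)
    then show ?thesis
      using C MCauchy_in_mspace[OF s(1)] by (auto simp: C.commute completion_embed_in intro!: bexI[of _ "\<sigma> k"])
  qed
  then show ?thesis
    by (auto simp: completion_metric_def C.metric_closure_of)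
qed

lemma mcomplete_completion_metric: "mcomplete_of (completion_metric m)"
proof -
  interpret C: Metric_space "completion_points m" "completion_dist m"
    by (rule Metric_space_completion)
  have "\<exists>D. limitin C.mtopology X D sequentially" if X: "C.MCauchy X" for X
  proof -
    have Xin: "X k \<in> completion_points m" for k
      using X by (auto simp: C.MCauchy_def)
    have "\<exists>P\<in>mspace m. completion_dist m (completion_embed m P) (X k) < inverse (Suc k)" for k
    proof -
      have "X k \<in> mtopology_of (completion_metric m) closure_of (completion_embed m ` mspace m)"
        using Xin by (simp add: completion_embed_dense)
      moreover have "inverse (real (Suc k)) > 0" by simp
      ultimately obtain P where "P \<in> mspace m" "completion_embed m P \<in> C.mball (X k) (inverse (Suc k))"
        unfolding completion_metric_def C.mtopology_of C.metric_closure_of by blast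
      then show ?thesis
        unfolding C.in_mball using C.commute by metis
    qed
    then obtain p where p: "\<And>k. p k \<in> mspace m"
      "\<And>k. completion_dist m (completion_embed m (p k)) (X k) < inverse (Suc k)"
      by metis
    have ein: "completion_embed m (p k) \<in> completion_points m" for k
      by (simp add: completion_embed_in p)
    have "Metric_space.MCauchy (mspace m) (mdist m) p"
      unfolding Metric_space.MCauchy_def[OF Metric_space_mspace_mdist]
    proof (intro conjI allI impI)
      show "range p \<subseteq> mspace m" using p by auto
      fix e :: real assume "e > 0"
      then have "e/3 > 0" by simp
      then obtain N0 where N0: "\<And>j k. N0 \<le> j \<Longrightarrow> N0 \<le> k \<Longrightarrow> completion_dist m (X j) (X k) < e/3"
        using X unfolding C.MCauchy_def by meson
      obtain N1 where N1: "inverse (real (Suc N1)) < e/3"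
        using reals_Archimedean[OF \<open>e/3 > 0\<close>] by blast
      have small: "completion_dist m (completion_embed m (p k)) (X k) < e/3" if "N1 \<le> k" for k
      proof -
        have "inverse (real (Suc k)) \<le> inverse (real (Suc N1))"
          using that by (intro le_imp_inverse_le) auto
        then show ?thesis using p(2)[of k] N1 by linarith
      qed
      have "mdist m (p j) (p k) < e" if "max N0 N1 \<le> j" "max N0 N1 \<le> k" for j k
        using small[of j] small[of k] N0[of j k] that
          C.triangle[OF ein[of j] Xin[of j] ein[of k]] C.triangle[OF Xin[of j] Xin[of k] ein[of k]]
          C.commute[of "X k" "completion_embed m (p k)"]
        unfolding completion_embed_isometry[OF p(1) p(1)] by linarith
      then show "\<exists>N. \<forall>j k. N \<le> j \<longrightarrow> N \<le> k \<longrightarrow> mdist m (p j) (p k) < e"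
        by blast
    qed
    note pC = this
    define D where "D = Cauchy_rel m `` {p}"
    have D: "D \<in> completion_points m"
      unfolding D_def by (rule completion_pointsI[OF pC])
    have "(\<lambda>k. completion_dist m (X k) D) \<longlonglongrightarrow> 0"
    proof (rule tendsto_sandwich[OF _ _ tendsto_const])
      show "(\<lambda>k. inverse (real (Suc k)) + completion_dist m (completion_embed m (p k)) D) \<longlonglongrightarrow> 0"
        unfolding D_def
        by (intro tendsto_add_zero completion_embed_tendsto pC LIMSEQ_inverse_real_of_nat)
      show "\<forall>\<^sub>F k in sequentially. completion_dist m (X k) D
          \<le> inverse (real (Suc k)) + completion_dist m (completion_embed m (p k)) D"
      proof (intro always_eventually allI)
        fix k
        show "completion_dist m (X k) D
            \<le> inverse (real (Suc k)) + completion_dist m (completion_embed m (p k)) D"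
          using C.triangle[OF Xin[of k] ein[of k] D] p(2)[of k]
            C.commute[of "X k" "completion_embed m (p k)"] by linarith
      qed
    qed (simp add: C.nonneg)
    then show ?thesis
      using D Xin by (auto simp: C.limitin_metric_dist_null intro!: exI[of _ D])
  qed
  then show ?thesis
    by (simp add: mcomplete_of_def C.mcomplete_def)
qed


section \<open>Configurations of pairwise disjoint oriented lines\<close>

text \<open>An oriented line is encoded by its unit direction vector and its point nearest the origin.\<close>

type_synonym oline = "(real ^ 3) \<times> (real ^ 3)"

definition oriented_lines :: "oline set" where
  "oriented_lines = {(v, x). v \<in> sphere 0 1 \<and> x \<bullet> v = 0}"

definition line_points :: "oline \<Rightarrow> (real ^ 3) set" where
  "line_points = (\<lambda>(v, x). {x + s *\<^sub>R v | s. True})"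

text \<open>Tuples of \<open>n = CARD('n) \<ge> 1\<close> lines are vectors indexed by the finite type \<open>'n\<close>; distances between
  tuples are the Euclidean ones of \<open>(\<real>\<^sup>3 \<times> \<real>\<^sup>3)\<^sup>n\<close>. The argument of type \<open>'n itself\<close> below only
  selects the index type.\<close>

definition line_tuples :: "'n::finite itself \<Rightarrow> (oline ^ 'n) set" where
  "line_tuples _ = {P. \<forall>i. P $ i \<in> oriented_lines}"

definition line_tuples0 :: "'n::finite itself \<Rightarrow> (oline ^ 'n) set" where
  "line_tuples0 N = {P \<in> line_tuples N. \<forall>i. snd (P $ i) = 0}"

definition Emb :: "'n::finite itself \<Rightarrow> (oline ^ 'n) set" where
  "Emb N = {P \<in> line_tuples N. \<forall>i j. i \<noteq> j \<longrightarrow> disjnt (line_points (P $ i)) (line_points (P $ j))}"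

definition Emb_path_metric :: "'n::finite itself \<Rightarrow> (oline ^ 'n) metric" where
  "Emb_path_metric N = metric (Emb N, path_dist (Emb N))"

definition Emb_hat :: "'n::finite itself \<Rightarrow> (nat \<Rightarrow> oline ^ 'n) set metric" where
  "Emb_hat N = completion_metric (Emb_path_metric N)"

text \<open>The continuous extension of the inclusion of \<open>Emb N\<close> into \<open>line_tuples N\<close>: a class of
  Cauchy sequences is sent to the common limit of its members for the Euclidean distance.\<close>

definition pi_hat :: "(nat \<Rightarrow> oline ^ 'n::finite) set \<Rightarrow> oline ^ 'n" where
  "pi_hat C = lim (SOME \<sigma>. \<sigma> \<in> C)"

definition E_hat :: "'n::finite itself \<Rightarrow> (nat \<Rightarrow> oline ^ 'n) set set" where
  "E_hat N = {C \<in> mspace (Emb_hat N). pi_hat C \<in> line_tuples0 N}"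

lemma mspace_Emb_path_metric [simp]: "mspace (Emb_path_metric N) = Emb N"
  and mdist_Emb_path_metric [simp]: "mdist (Emb_path_metric N) = path_dist (Emb N)"
  by (simp_all add: Emb_path_metric_def Metric_space.mspace_metric Metric_space.mdist_metric
      Metric_space_path_dist)

lemma closed_line_tuples: "closed (line_tuples N)"
proof -
  have "closed oriented_lines"
    unfolding oriented_lines_def case_prod_beta
    by (auto simp: dist_norm intro!: closed_Collect_conj closed_Collect_eq continuous_intros)
  then have "closed {P :: oline ^ 'n. \<forall>i. P $ i \<in> oriented_lines}"
    by (intro closed_Collect_all closed_vimage[unfolded vimage_def] continuous_intros)
  then show ?thesis by (simp add: line_tuples_def)
qed

lemma MCauchy_Emb_imp_Cauchy:
  assumes "Metric_space.MCauchy (Emb N) (path_dist (Emb N)) \<sigma>"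
  shows "Cauchy \<sigma>"
proof (rule metric_CauchyI)
  fix e :: real assume "e > 0"
  then have "min e 1 > 0" by simp
  then obtain K where K: "\<And>j k. K \<le> j \<Longrightarrow> K \<le> k \<Longrightarrow> path_dist (Emb N) (\<sigma> j) (\<sigma> k) < min e 1"
    using assms unfolding Metric_space.MCauchy_def[OF Metric_space_path_dist] by meson
  have "dist (\<sigma> j) (\<sigma> k) < e" if "K \<le> j" "K \<le> k" for j k
    using K[OF that] dist_le_path_dist[of "\<sigma> j" "\<sigma> k" "Emb N"] by linarith
  then show "\<exists>K. \<forall>j\<ge>K. \<forall>k\<ge>K. dist (\<sigma> j) (\<sigma> k) < e" by blast
qed

lemma pi_hat_tendsto:
  assumes "Metric_space.MCauchy (Emb N) (path_dist (Emb N)) \<sigma>"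
  shows "\<sigma> \<longlonglongrightarrow> pi_hat (Cauchy_rel (Emb_path_metric N) `` {\<sigma>})"
proof -
  define \<tau> where "\<tau> = (SOME \<tau>. \<tau> \<in> Cauchy_rel (Emb_path_metric N) `` {\<sigma>})"
  have "(\<sigma>, \<tau>) \<in> Cauchy_rel (Emb_path_metric N)"
    unfolding \<tau>_def by (rule Cauchy_rel_some) (use assms in simp)
  then have t: "Metric_space.MCauchy (Emb N) (path_dist (Emb N)) \<tau>"
    and st: "(\<lambda>k. path_dist (Emb N) (\<sigma> k) (\<tau> k)) \<longlonglongrightarrow> 0"
    by (simp_all add: Cauchy_rel_iff)
  have lt: "\<tau> \<longlonglongrightarrow> lim \<tau>"
    using MCauchy_Emb_imp_Cauchy[OF t] unfolding Cauchy_convergent_iff convergent_LIMSEQ_iff .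
  have "(\<lambda>k. dist (\<sigma> k) (\<tau> k)) \<longlonglongrightarrow> 0"
  proof (rule tendsto_sandwich[OF _ _ tendsto_const st])
    have "\<forall>\<^sub>F k in sequentially. path_dist (Emb N) (\<sigma> k) (\<tau> k) < 1"
      using st by (rule order_tendstoD) simp
    then show "\<forall>\<^sub>F k in sequentially. dist (\<sigma> k) (\<tau> k) \<le> path_dist (Emb N) (\<sigma> k) (\<tau> k)"
    proof eventually_elim
      case (elim k)
      then show ?case using dist_le_path_dist[of "\<sigma> k" "\<tau> k" "Emb N"] by linarith
    qed
  qed simp
  then have "(\<lambda>k. \<sigma> k - \<tau> k) \<longlonglongrightarrow> 0"
    unfolding dist_norm by (rule tendsto_norm_zero_cancel)
  then have "\<sigma> \<longlonglongrightarrow> lim \<tau>"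
    by (rule Lim_transform[OF lt])
  then show ?thesis unfolding pi_hat_def \<tau>_def[symmetric] .
qed

lemma pi_hat_embed:
  assumes "P \<in> Emb N" shows "pi_hat (completion_embed (Emb_path_metric N) P) = P"
proof -
  have "(\<lambda>k::nat. P) \<longlonglongrightarrow> pi_hat (completion_embed (Emb_path_metric N) P)"
    unfolding completion_embed_def
    by (rule pi_hat_tendsto) (simp add: assms Metric_space.MCauchy_const[OF Metric_space_path_dist])
  then show ?thesis by (simp add: LIMSEQ_const_iff)
qed

lemma continuous_map_pi_hat:
  "continuous_map (mtopology_of (Emb_hat N)) (top_of_set (line_tuples N)) pi_hat"
proof -
  let ?m = "Emb_path_metric N"
  interpret C: Metric_space "completion_points ?m" "completion_dist ?m"
    by (rule Metric_space_completion)
  have im: "pi_hat C \<in> line_tuples N" if C: "C \<in> completion_points ?m" for C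
  proof -
    obtain \<sigma> where s0: "Metric_space.MCauchy (mspace ?m) (mdist ?m) \<sigma>" "C = Cauchy_rel ?m `` {\<sigma>}"
      using C by (rule completion_pointsE)
    note s = s0[unfolded mspace_Emb_path_metric mdist_Emb_path_metric]
    have "\<sigma> k \<in> line_tuples N" for k
      using s(1) by (auto simp: Metric_space.MCauchy_def[OF Metric_space_path_dist] Emb_def)
    then show ?thesis
      unfolding s(2) using pi_hat_tendsto[OF s(1)] by (rule closed_sequentially[OF closed_line_tuples])
  qed
  have near: "dist (pi_hat C) (pi_hat D) < e"
    if CD: "C \<in> completion_points ?m" "D \<in> completion_points ?m"
      and lt: "completion_dist ?m C D < min (e/2) 1" and "e > 0" for C D e
  proof -
    obtain \<sigma> where s0: "Metric_space.MCauchy (mspace ?m) (mdist ?m) \<sigma>" "C = Cauchy_rel ?m `` {\<sigma>}"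
      using CD(1) by (rule completion_pointsE)
    note s = s0[unfolded mspace_Emb_path_metric mdist_Emb_path_metric]
    obtain \<tau> where t0: "Metric_space.MCauchy (mspace ?m) (mdist ?m) \<tau>" "D = Cauchy_rel ?m `` {\<tau>}"
      using CD(2) by (rule completion_pointsE)
    note t = t0[unfolded mspace_Emb_path_metric mdist_Emb_path_metric]
    have "(\<lambda>k. path_dist (Emb N) (\<sigma> k) (\<tau> k)) \<longlonglongrightarrow> completion_dist ?m C D"
      using tendsto_completion_dist[OF s0(1) t0(1)] unfolding s(2) t(2) mdist_Emb_path_metric .
    then have "\<forall>\<^sub>F k in sequentially. path_dist (Emb N) (\<sigma> k) (\<tau> k) < min (e/2) 1"
      using lt by (rule order_tendstoD)
    then have "\<forall>\<^sub>F k in sequentially. dist (\<sigma> k) (\<tau> k) \<le> e/2"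
    proof eventually_elim
      case (elim k)
      then show ?case using dist_le_path_dist[of "\<sigma> k" "\<tau> k" "Emb N"] by linarith
    qed
    moreover have "(\<lambda>k. dist (\<sigma> k) (\<tau> k)) \<longlonglongrightarrow> dist (pi_hat C) (pi_hat D)"
      unfolding s(2) t(2) by (intro tendsto_dist pi_hat_tendsto s(1) t(1))
    ultimately have "dist (pi_hat C) (pi_hat D) \<le> e/2"
      using tendsto_upperbound trivial_limit_sequentially by blast
    then show ?thesis using \<open>e > 0\<close> by simp
  qed
  have "continuous_map C.mtopology Met_TC.mtopology pi_hat"
    unfolding C.metric_continuous_map[OF Met_TC.Metric_space_axioms]
  proof (intro conjI ballI allI impI)
    fix C and e :: real assume "C \<in> completion_points ?m" "e > 0"
    then show "\<exists>d>0. \<forall>D. D \<in> completion_points ?m \<and> completion_dist ?m C D < d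
        \<longrightarrow> dist (pi_hat C) (pi_hat D) < e"
      by (intro exI[of _ "min (e/2) 1"]) (use near in auto)
  qed simp
  then show ?thesis
    using im by (auto simp: Emb_hat_def completion_metric_def continuous_map_in_subtopology)
qed

end

theory Submission
  imports Defs
begin

text \<open>Scaling \<open>\<real>\<^sup>3\<close> by \<open>t \<in> (0, 1]\<close> sends the line \<open>(v, x)\<close> to \<open>(v, t x)\<close> and keeps disjoint lines
  disjoint. It does not increase lengths of curves, and the orbit of \<open>(v, x)\<close> between times \<open>s\<close> and \<open>t\<close>
  has length at most \<open>\<bar>s - t\<bar> \<parallel>x\<parallel>\<close>. Hence the scaling extends to the completion jointly
  continuously up to \<open>t = 0\<close>. Points of the completion over tuples of lines through the origin are
  fixed, since for a representing Cauchy sequence the lengths of the orbits tend to 0, so this is a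
  strong deformation retraction onto \<open>E_hat\<close>.\<close>

section \<open>Length bounds for Lipschitz curves and nonexpansive maps\<close>

text \<open>Each chord is at most \<open>L\<close> times its parameter step, and the steps telescope
  to 1.\<close>

lemma curve_length_Lipschitz:
  assumes "L-lipschitz_on {0..1} g"
  shows "curve_length g \<le> ennreal L"
proof (rule curve_length_least)
  fix m :: nat and t :: "nat \<Rightarrow> real"
  assume t: "mono_on {..m} t" "t 0 = 0" "t m = 1"
  have le: "t i \<le> t j" if "i \<le> j" "j \<le> m" for i j
    using t(1) that by (auto simp: mono_on_def)
  have "(\<Sum>i<m. dist (g (t i)) (g (t (Suc i)))) \<le> (\<Sum>i<m. L * (t (Suc i) - t i))"
  proof (rule sum_mono)
    fix i assume "i \<in> {..<m}"
    then have "0 \<le> t i" "t i \<le> t (Suc i)" "t (Suc i) \<le> 1"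
      using le[of 0 i] le[of i "Suc i"] le[of "Suc i" m] t by auto
    then show "dist (g (t i)) (g (t (Suc i))) \<le> L * (t (Suc i) - t i)"
      using lipschitz_onD[OF assms, of "t i" "t (Suc i)"] by (simp add: dist_real_def)
  qed
  also have "\<dots> = L"
    using t by (simp add: sum_lessThan_telescope flip: sum_distrib_left)
  finally show "ennreal (\<Sum>i<m. dist (g (t i)) (g (t (Suc i)))) \<le> ennreal L"
    by (rule ennreal_leI)
qed

lemma curve_length_compose_le:
  fixes g :: "real \<Rightarrow> 'a::metric_space" and f :: "'a \<Rightarrow> 'b::metric_space"
  assumes "\<And>x y. dist (f x) (f y) \<le> dist x y"
  shows "curve_length (f \<circ> g) \<le> curve_length g"
proof (rule curve_length_least)
  fix m :: nat and t :: "nat \<Rightarrow> real"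
  assume t: "mono_on {..m} t" "t 0 = 0" "t m = 1"
  have "ennreal (\<Sum>i<m. dist ((f \<circ> g) (t i)) ((f \<circ> g) (t (Suc i))))
      \<le> ennreal (\<Sum>i<m. dist (g (t i)) (g (t (Suc i))))"
    by (intro ennreal_leI sum_mono) (simp add: assms)
  also have "\<dots> \<le> curve_length g"
    using t by (rule curve_length_upper)
  finally show "ennreal (\<Sum>i<m. dist ((f \<circ> g) (t i)) ((f \<circ> g) (t (Suc i)))) \<le> curve_length g" .
qed

text \<open>The curve itself is a competitor in the infimum. This is how scaling orbits give upper
  bounds on the path metric.\<close>

lemma path_dist_le_Lipschitz:
  fixes g :: "real \<Rightarrow> 'a::metric_space"
  assumes g: "L-lipschitz_on {0..1} g" and "g ` {0..1} \<subseteq> S"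
  shows "path_dist S (g 0) (g 1) \<le> L"
proof -
  have "curve_length g < \<infinity>"
    using le_less_trans[OF curve_length_Lipschitz[OF g]] by simp
  then have "length_dist S (g 0) (g 1) \<le> curve_length g"
    unfolding length_dist_def using assms(2) lipschitz_on_continuous_on[OF g]
    by (intro INF_lower)
       (auto simp: rectifiable_path_def path_def path_image_def pathstart_def pathfinish_def)
  also have "\<dots> \<le> ennreal L"
    by (rule curve_length_Lipschitz[OF g])
  finally have "ennreal (path_dist S (g 0) (g 1)) \<le> ennreal L"
    unfolding ennreal_path_dist by (rule min.coboundedI1)
  then show ?thesis
    using lipschitz_on_nonneg[OF g] by simp
qed

text \<open>Composing with \<open>f\<close> turns a rectifiable path in \<open>S\<close> into one in
  \<open>T\<close> that is no longer; being nonexpansive everywhere also makes \<open>f\<close>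
  continuous. Applied to scaling by a fixed factor.\<close>

lemma path_dist_compose_le:
  fixes f :: "'a::metric_space \<Rightarrow> 'b::metric_space"
  assumes f: "\<And>x y. dist (f x) (f y) \<le> dist x y" and S: "f ` S \<subseteq> T"
  shows "path_dist T (f P) (f Q) \<le> path_dist S P Q"
proof -
  have "length_dist T (f P) (f Q) \<le> curve_length g"
    if g: "rectifiable_path g" "path_image g \<subseteq> S" "pathstart g = P" "pathfinish g = Q" for g
  proof -
    have "1-lipschitz_on UNIV f"
      using f by (intro lipschitz_onI) auto
    then have "continuous_on UNIV f"
      by (rule lipschitz_on_continuous_on)
    then have "path (f \<circ> g)"
      using g(1) by (auto simp: rectifiable_path_def intro!: path_continuous_image intro: continuous_on_subset)
    moreover have "curve_length (f \<circ> g) \<le> curve_length g"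
      using f by (rule curve_length_compose_le)
    ultimately have "length_dist T (f P) (f Q) \<le> curve_length (f \<circ> g)"
      unfolding length_dist_def using g S
      by (intro INF_lower)
         (auto simp: rectifiable_path_def path_image_compose pathstart_compose pathfinish_compose)
    also note \<open>\<dots> \<le> curve_length g\<close>
    finally show ?thesis .
  qed
  then have "length_dist T (f P) (f Q) \<le> length_dist S P Q"
    unfolding length_dist_def[of S] by (intro INF_greatest) auto
  then have "ennreal (path_dist T (f P) (f Q)) \<le> ennreal (path_dist S P Q)"
    unfolding ennreal_path_dist by (intro min.mono) auto
  then show ?thesis
    by (metis enn2real_nonneg ennreal_le_iff path_dist_def)
qed

section \<open>Scaling tuples of lines\<close>

definition scale_lines :: "real \<Rightarrow> oline ^ 'n \<Rightarrow> oline ^ 'n" where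
  "scale_lines t P = (\<chi> i. (fst (P $ i), t *\<^sub>R snd (P $ i)))"

lemma scale_lines_1 [simp]: "scale_lines 1 P = P"
  by (simp add: scale_lines_def vec_eq_iff)

text \<open>In each coordinate the direction part is untouched and the position part is contracted;
  monotonicity of the Euclidean norm then combines the coordinates.\<close>

lemma dist_scale_lines_le:
  fixes P Q :: "oline ^ 'n::finite"
  assumes "\<bar>t\<bar> \<le> 1"
  shows "dist (scale_lines t P) (scale_lines t Q) \<le> dist P Q"
proof -
  have *: "dist (t *\<^sub>R x) (t *\<^sub>R y) \<le> dist x y" for x y :: "real ^ 3"
    using assms by (simp add: dist_norm mult_left_le_one_le flip: scaleR_diff_right)
  have "dist (scale_lines t P $ i) (scale_lines t Q $ i) \<le> dist (P $ i) (Q $ i)" for i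
    using power_mono[OF *, of "snd (P $ i)" "snd (Q $ i)" 2] by (simp add: scale_lines_def dist_prod_def)
  then show ?thesis
    unfolding dist_vec_def[where 'a = oline] by (intro L2_set_mono) simp_all
qed

lemma tendsto_scale_lines [tendsto_intros]:
  assumes "(f \<longlongrightarrow> t) F" "(g \<longlongrightarrow> P) F"
  shows "((\<lambda>x. scale_lines (f x) (g x)) \<longlongrightarrow> scale_lines t P) F"
  unfolding scale_lines_def by (intro tendsto_intros assms)

text \<open>The norm of the vector of positions, that is, the speed of the scaling orbit of \<open>P\<close>.\<close>

definition pos_norm :: "oline ^ 'n::finite \<Rightarrow> real" where
  "pos_norm P = dist P (scale_lines 0 P)"

text \<open>In the ambient vector space the orbit is affine in time, with velocity
  \<open>P - scale_lines 0 P\<close>.\<close>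

lemma dist_scale_lines_time:
  "dist (scale_lines s P) (scale_lines t P) = \<bar>s - t\<bar> * pos_norm P"
proof -
  have "scale_lines s P - scale_lines t P = (s - t) *\<^sub>R (P - scale_lines 0 P)"
    by (simp add: vec_eq_iff scale_lines_def prod_eq_iff scaleR_diff_left)
  then show ?thesis by (simp add: dist_norm pos_norm_def)
qed

lemma tendsto_pos_norm [tendsto_intros]:
  "(g \<longlongrightarrow> P) F \<Longrightarrow> ((\<lambda>x. pos_norm (g x)) \<longlongrightarrow> pos_norm P) F"
  unfolding pos_norm_def by (intro tendsto_intros)

lemma pos_norm_nonneg [simp]: "0 \<le> pos_norm P"
  by (simp add: pos_norm_def)

text \<open>The parameter \<open>s\<close> of a point becomes \<open>t * s\<close> after scaling,
  and this reparametrization is onto because \<open>t\<close> is nonzero.\<close>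

lemma line_points_scale:
  assumes "t \<noteq> 0"
  shows "line_points (v, t *\<^sub>R x) = (*\<^sub>R) t ` line_points (v, x)"
proof -
  have range: "line_points (v, y) = range (\<lambda>s. y + s *\<^sub>R v)" for y
    by (auto simp: line_points_def)
  have "surj ((*) t)"
    using assms by (intro surjI[of _ "\<lambda>s. s / t"]) simp
  then have "line_points (v, t *\<^sub>R x) = (\<lambda>s. t *\<^sub>R x + s *\<^sub>R v) ` range ((*) t)"
    by (simp only: range)
  also have "\<dots> = (*\<^sub>R) t ` line_points (v, x)"
    by (simp only: range image_image scaleR_add_right scaleR_scaleR)
  finally show ?thesis .
qed

text \<open>A homothety with nonzero factor is injective, so it maps disjoint lines to disjoint
  lines. At factor 0 all lines would meet at the origin.\<close>

lemma scale_lines_Emb: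
  assumes "0 < t" "P \<in> Emb N"
  shows "scale_lines t P \<in> Emb N"
proof -
  have "line_points (scale_lines t P $ i) = (*\<^sub>R) t ` line_points (P $ i)" for i
    using line_points_scale[of t "fst (P $ i)" "snd (P $ i)"] assms(1) by (simp add: scale_lines_def)
  moreover have "inj ((*\<^sub>R) t :: real ^ 3 \<Rightarrow> real ^ 3)"
    using assms(1) by (simp add: inj_on_def)
  moreover have "scale_lines t P \<in> line_tuples N"
    using assms(2) by (auto simp: Emb_def line_tuples_def oriented_lines_def scale_lines_def case_prod_beta)
  ultimately show ?thesis
    using assms(2) by (auto simp: Emb_def disjnt_def simp flip: image_Int)
qed

lemma path_dist_scale_lines_time:
  fixes N :: "'n::finite itself"
  assumes "0 < s" "0 < t" "P \<in> Emb N"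
  shows "path_dist (Emb N) (scale_lines s P) (scale_lines t P) \<le> \<bar>s - t\<bar> * pos_norm P"
proof -
  define g where "g u = scale_lines ((1 - u) * s + u * t) P" for u
  have "(\<bar>s - t\<bar> * pos_norm P)-lipschitz_on {0..1} g"
  proof (rule lipschitz_onI)
    fix u w :: real
    have "((1 - u) * s + u * t) - ((1 - w) * s + w * t) = (w - u) * (s - t)"
      by (simp add: algebra_simps)
    then show "dist (g u) (g w) \<le> \<bar>s - t\<bar> * pos_norm P * dist u w"
      unfolding g_def
      using dist_scale_lines_time[of "(1 - u) * s + u * t" P "(1 - w) * s + w * t"]
      by (simp add: abs_mult dist_real_def abs_minus_commute mult_ac)
  qed simp
  \<comment> \<open>Interpolated times between two positive times stay positive, so the orbit
    segment never leaves \<open>Emb N\<close>.\<close>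
  moreover have "0 < (1 - u) * s + u * t" if "0 \<le> u" "u \<le> 1" for u
    using that assms(1,2) by (cases "u = 0") (auto intro: add_nonneg_pos)
  then have "g ` {0..1} \<subseteq> Emb N"
    using assms(3) by (auto simp: g_def intro!: scale_lines_Emb)
  ultimately show ?thesis
    using path_dist_le_Lipschitz[of "\<bar>s - t\<bar> * pos_norm P" g "Emb N"] by (simp add: g_def)
qed

text \<open>Triangle inequality through \<open>scale_lines t P\<close>: first move along the orbit
  of \<open>P\<close>, then compare \<open>P\<close> and \<open>Q\<close> at the fixed time
  \<open>t\<close>, where scaling contracts because \<open>t \<le> 1\<close>. Only the speed of
  \<open>P\<close> enters, which later gives continuity at a given point.\<close>

lemma path_dist_scale_lines:
  fixes N :: "'n::finite itself"
  assumes s: "0 < s" and t: "0 < t" "t \<le> 1" and P: "P \<in> Emb N" and Q: "Q \<in> Emb N"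
  shows "path_dist (Emb N) (scale_lines s P) (scale_lines t Q)
    \<le> \<bar>s - t\<bar> * pos_norm P + path_dist (Emb N) P Q"
proof -
  have "path_dist (Emb N) (scale_lines s P) (scale_lines t Q)
      \<le> path_dist (Emb N) (scale_lines s P) (scale_lines t P)
        + path_dist (Emb N) (scale_lines t P) (scale_lines t Q)"
    by (intro Metric_space.triangle[OF Metric_space_path_dist] scale_lines_Emb assms)
  moreover have "path_dist (Emb N) (scale_lines t P) (scale_lines t Q) \<le> path_dist (Emb N) P Q"
    using t by (intro path_dist_compose_le dist_scale_lines_le) (auto intro: scale_lines_Emb)
  ultimately show ?thesis
    using path_dist_scale_lines_time[OF s t(1) P] by linarith
qed

section \<open>Scaling Cauchy sequences and points of the completion\<close>

abbreviation MCauchy_Emb :: "'n::finite itself \<Rightarrow> (nat \<Rightarrow> oline ^ 'n) \<Rightarrow> bool" where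
  "MCauchy_Emb N \<equiv> Metric_space.MCauchy (Emb N) (path_dist (Emb N))"

text \<open>The time is kept positive along the sequence so that the scaled tuples stay in \<open>Emb\<close> even
  for \<open>t = 0\<close>.\<close>

definition scale_time :: "real \<Rightarrow> nat \<Rightarrow> real" where
  "scale_time t k = max t (inverse (real (Suc k)))"

definition scale_seq :: "real \<Rightarrow> (nat \<Rightarrow> oline ^ 'n) \<Rightarrow> nat \<Rightarrow> oline ^ 'n" where
  "scale_seq t \<sigma> k = scale_lines (scale_time t k) (\<sigma> k)"

text \<open>The class is computed from one chosen representative. By
  \<open>some_representative\<close> this choice represents \<open>C\<close>, so estimates for
  \<open>scale_hat\<close> reduce to estimates along the chosen sequences.\<close>

definition scale_hat ::
  "'n::finite itself \<Rightarrow> real \<times> (nat \<Rightarrow> oline ^ 'n) set \<Rightarrow> (nat \<Rightarrow> oline ^ 'n) set" where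
  "scale_hat N = (\<lambda>(t, C). Cauchy_rel (Emb_path_metric N) `` {scale_seq t (SOME \<sigma>. \<sigma> \<in> C)})"

lemma scale_time_pos: "0 < scale_time t k"
  by (simp add: scale_time_def less_max_iff_disj)

lemma scale_time_le_1: "t \<le> 1 \<Longrightarrow> scale_time t k \<le> 1"
  by (simp add: scale_time_def inverse_le_1_iff)

lemma scale_time_diff: "\<bar>scale_time s k - scale_time t k\<bar> \<le> \<bar>s - t\<bar>"
  by (auto simp: scale_time_def max_def)

lemma scale_time_tendsto: "0 \<le> t \<Longrightarrow> scale_time t \<longlonglongrightarrow> t"
proof -
  assume "0 \<le> t"
  have "(\<lambda>k. max t (inverse (real (Suc k)))) \<longlonglongrightarrow> max t 0"
    by (intro tendsto_max tendsto_const LIMSEQ_inverse_real_of_nat)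
  then show ?thesis
    using \<open>0 \<le> t\<close> by (simp add: scale_time_def[abs_def])
qed

lemma MCauchy_Emb_in: "MCauchy_Emb N \<sigma> \<Longrightarrow> \<sigma> k \<in> Emb N"
  by (auto simp: Metric_space.MCauchy_def[OF Metric_space_path_dist])

text \<open>The sequence converges in the Euclidean metric, so its speeds \<open>pos_norm\<close>
  are bounded. As the times converge too, \<open>path_dist_scale_lines\<close> controls both sources
  of variation.\<close>

lemma MCauchy_scale_seq:
  assumes t: "0 \<le> t" "t \<le> 1" and \<sigma>: "MCauchy_Emb N \<sigma>"
  shows "MCauchy_Emb N (scale_seq t \<sigma>)"
  unfolding Metric_space.MCauchy_def[OF Metric_space_path_dist]
proof (intro conjI allI impI)
  show "range (scale_seq t \<sigma>) \<subseteq> Emb N"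
    using MCauchy_Emb_in[OF \<sigma>] by (auto simp: scale_seq_def intro!: scale_lines_Emb scale_time_pos)
  fix e :: real assume "e > 0"
  have "Bseq (\<lambda>k. pos_norm (\<sigma> k))"
    using tendsto_pos_norm[OF pi_hat_tendsto[OF \<sigma>]] by (intro convergent_imp_Bseq convergentI)
  then obtain B where B: "B > 0" "\<And>k. pos_norm (\<sigma> k) \<le> B"
    by (auto simp: Bseq_def)
  have "Cauchy (scale_time t)"
    using scale_time_tendsto[OF t(1)] by (rule LIMSEQ_imp_Cauchy)
  \<comment> \<open>Multiplied by the bound \<open>B\<close> on the speeds, this tolerance leaves
    \<open>e / 2\<close> for the change of time.\<close>
  then obtain K1 where K1: "\<And>j k. K1 \<le> j \<Longrightarrow> K1 \<le> k \<Longrightarrow> dist (scale_time t j) (scale_time t k) < e / (2 * B)"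
    using \<open>e > 0\<close> B(1) unfolding Cauchy_def by (meson divide_pos_pos mult_pos_pos zero_less_numeral)
  have "e / 2 > 0" using \<open>e > 0\<close> by simp
  then obtain K2 where K2: "\<And>j k. K2 \<le> j \<Longrightarrow> K2 \<le> k \<Longrightarrow> path_dist (Emb N) (\<sigma> j) (\<sigma> k) < e / 2"
    using \<sigma> unfolding Metric_space.MCauchy_def[OF Metric_space_path_dist] by meson
  have "path_dist (Emb N) (scale_seq t \<sigma> j) (scale_seq t \<sigma> k) < e"
    if jk: "max K1 K2 \<le> j" "max K1 K2 \<le> k" for j k
  proof -
    have "path_dist (Emb N) (scale_seq t \<sigma> j) (scale_seq t \<sigma> k)
        \<le> \<bar>scale_time t j - scale_time t k\<bar> * pos_norm (\<sigma> j) + path_dist (Emb N) (\<sigma> j) (\<sigma> k)"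
      unfolding scale_seq_def
      by (intro path_dist_scale_lines scale_time_pos scale_time_le_1 t MCauchy_Emb_in[OF \<sigma>])
    also have "\<bar>scale_time t j - scale_time t k\<bar> * pos_norm (\<sigma> j) \<le> e / (2 * B) * B"
      using K1[of j k] jk B by (intro mult_mono) (auto simp: dist_real_def)
    also have "\<dots> = e / 2" using B(1) by simp
    finally show ?thesis using K2[of j k] jk by linarith
  qed
  then show "\<exists>K. \<forall>j k. K \<le> j \<longrightarrow> K \<le> k
      \<longrightarrow> path_dist (Emb N) (scale_seq t \<sigma> j) (scale_seq t \<sigma> k) < e"
    by blast
qed

lemma some_representative:
  fixes N :: "'n::finite itself"
  assumes "C \<in> completion_points (Emb_path_metric N)"
  shows "MCauchy_Emb N (SOME \<sigma>. \<sigma> \<in> C)"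
    and "Cauchy_rel (Emb_path_metric N) `` {SOME \<sigma>. \<sigma> \<in> C} = C"
    and "(SOME \<sigma>. \<sigma> \<in> C) \<longlonglongrightarrow> pi_hat C"
proof -
  obtain \<sigma> where "Metric_space.MCauchy (mspace (Emb_path_metric N)) (mdist (Emb_path_metric N)) \<sigma>"
    and C: "C = Cauchy_rel (Emb_path_metric N) `` {\<sigma>}"
    using assms by (rule completion_pointsE)
  then have *: "(\<sigma>, SOME \<tau>. \<tau> \<in> C) \<in> Cauchy_rel (Emb_path_metric N)"
    using Cauchy_rel_some by blast
  then show 1: "MCauchy_Emb N (SOME \<sigma>. \<sigma> \<in> C)"
    by (simp add: Cauchy_rel_iff)
  show 2: "Cauchy_rel (Emb_path_metric N) `` {SOME \<sigma>. \<sigma> \<in> C} = C"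
    using equiv_class_eq[OF equiv_Cauchy_rel *] unfolding C[symmetric] by (rule sym)
  show "(SOME \<sigma>. \<sigma> \<in> C) \<longlonglongrightarrow> pi_hat C"
    using pi_hat_tendsto[OF 1] by (simp add: 2)
qed

lemma scale_hat_in:
  assumes "0 \<le> t" "t \<le> 1" "C \<in> completion_points (Emb_path_metric N)"
  shows "scale_hat N (t, C) \<in> completion_points (Emb_path_metric N)"
  unfolding scale_hat_def prod.case
  by (intro completion_pointsI) (simp add: MCauchy_scale_seq some_representative assms)

text \<open>The estimate for tuples, applied termwise, passes to the limit. It yields both the joint
  continuity of \<open>scale_hat\<close> and the fact that points with vanishing limit speed do not
  move.\<close>

lemma scale_hat_dist:
  fixes N :: "'n::finite itself"
  defines "m \<equiv> Emb_path_metric N"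
  assumes s: "0 \<le> s" "s \<le> 1" and t: "0 \<le> t" "t \<le> 1"
    and C: "C \<in> completion_points m" and D: "D \<in> completion_points m"
  shows "completion_dist m (scale_hat N (s, C)) (scale_hat N (t, D))
    \<le> \<bar>s - t\<bar> * pos_norm (pi_hat C) + completion_dist m C D"
proof -
  define \<sigma> where "\<sigma> = (SOME \<sigma>. \<sigma> \<in> C)"
  define \<tau> where "\<tau> = (SOME \<tau>. \<tau> \<in> D)"
  note \<sigma> = some_representative[OF C[unfolded m_def], folded \<sigma>_def m_def]
  note \<tau> = some_representative[OF D[unfolded m_def], folded \<tau>_def m_def]
  have "(\<lambda>k. mdist m (\<sigma> k) (\<tau> k)) \<longlonglongrightarrow> completion_dist m C D"
    using tendsto_completion_dist[of m \<sigma> \<tau>] \<sigma> \<tau> by (simp add: m_def)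
  then have "(\<lambda>k. \<bar>s - t\<bar> * pos_norm (\<sigma> k) + path_dist (Emb N) (\<sigma> k) (\<tau> k))
      \<longlonglongrightarrow> \<bar>s - t\<bar> * pos_norm (pi_hat C) + completion_dist m C D"
    by (intro tendsto_intros \<sigma>(3)) (simp add: m_def)
  moreover have "(\<lambda>k. path_dist (Emb N) (scale_seq s \<sigma> k) (scale_seq t \<tau> k))
      \<longlonglongrightarrow> completion_dist m (scale_hat N (s, C)) (scale_hat N (t, D))"
    using tendsto_completion_dist[of m "scale_seq s \<sigma>" "scale_seq t \<tau>"]
      MCauchy_scale_seq[OF s \<sigma>(1)] MCauchy_scale_seq[OF t \<tau>(1)]
    by (simp add: m_def scale_hat_def \<sigma>_def \<tau>_def)
  moreover have "path_dist (Emb N) (scale_seq s \<sigma> k) (scale_seq t \<tau> k)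
      \<le> \<bar>s - t\<bar> * pos_norm (\<sigma> k) + path_dist (Emb N) (\<sigma> k) (\<tau> k)" for k
  proof -
    have "path_dist (Emb N) (scale_seq s \<sigma> k) (scale_seq t \<tau> k)
        \<le> \<bar>scale_time s k - scale_time t k\<bar> * pos_norm (\<sigma> k) + path_dist (Emb N) (\<sigma> k) (\<tau> k)"
      unfolding scale_seq_def
      by (intro path_dist_scale_lines scale_time_pos scale_time_le_1 t
          MCauchy_Emb_in[OF \<sigma>(1)] MCauchy_Emb_in[OF \<tau>(1)])
    also have "\<bar>scale_time s k - scale_time t k\<bar> * pos_norm (\<sigma> k) \<le> \<bar>s - t\<bar> * pos_norm (\<sigma> k)"
      by (intro mult_right_mono scale_time_diff) simp
    finally show ?thesis by simp
  qed
  ultimately show ?thesis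
    by (meson LIMSEQ_le)
qed

lemma scale_hat_1:
  assumes "C \<in> completion_points (Emb_path_metric N)"
  shows "scale_hat N (1, C) = C"
proof -
  \<comment> \<open>The positive lower cutoff in \<open>scale_time\<close> never exceeds 1, so at
    time 1 it has no effect.\<close>
  have "scale_seq 1 \<sigma> = \<sigma>" for \<sigma> :: "nat \<Rightarrow> oline ^ 'a"
    by (rule ext) (simp add: scale_seq_def scale_time_def max_absorb1 inverse_le_1_iff)
  then show ?thesis
    by (simp add: scale_hat_def some_representative[OF assms])
qed

text \<open>Both sides are the Euclidean limit of the same scaled sequence. At \<open>t = 0\<close>
  the terms have positive times, but these tend to 0.\<close>

lemma pi_hat_scale_hat:
  assumes t: "0 \<le> t" "t \<le> 1" and C: "C \<in> completion_points (Emb_path_metric N)"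
  shows "pi_hat (scale_hat N (t, C)) = scale_lines t (pi_hat C)"
proof (rule LIMSEQ_unique)
  define \<sigma> where "\<sigma> = (SOME \<sigma>. \<sigma> \<in> C)"
  note \<sigma> = some_representative[OF C, folded \<sigma>_def]
  show "scale_seq t \<sigma> \<longlonglongrightarrow> pi_hat (scale_hat N (t, C))"
    using pi_hat_tendsto[OF MCauchy_scale_seq[OF t \<sigma>(1)]] by (simp add: scale_hat_def \<sigma>_def)
  show "scale_seq t \<sigma> \<longlonglongrightarrow> scale_lines t (pi_hat C)"
    unfolding scale_seq_def[abs_def] scale_lines_def
    by (intro tendsto_intros scale_time_tendsto t(1) \<sigma>(3))
qed

section \<open>The retraction onto \<open>E_hat\<close> and its homotopy\<close>

lemma pi_hat_in_line_tuples:
  assumes "C \<in> completion_points (Emb_path_metric N)"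
  shows "pi_hat C \<in> line_tuples N"
  using continuous_map_funspace[OF continuous_map_pi_hat[of N]] assms
  by (auto simp: Emb_hat_def Pi_iff)

lemma E_hat_eq:
  "E_hat N = {C \<in> completion_points (Emb_path_metric N). pi_hat C \<in> line_tuples0 N}"
  by (simp add: E_hat_def Emb_hat_def)

lemma scale_hat_0_in_E_hat:
  assumes "C \<in> completion_points (Emb_path_metric N)"
  shows "scale_hat N (0, C) \<in> E_hat N"
  using scale_hat_in[of 0 C N] pi_hat_scale_hat[of 0 C N] assms
    pi_hat_in_line_tuples[of "scale_hat N (0, C)" N]
  by (simp add: E_hat_eq line_tuples0_def scale_lines_def)

text \<open>The limit tuple has no position part, hence speed 0, so \<open>scale_hat_dist\<close>
  between times \<open>t\<close> and 1 at the same point gives distance 0 to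
  \<open>scale_hat N (1, C) = C\<close>.\<close>

lemma scale_hat_fixes_E_hat:
  assumes t: "0 \<le> t" "t \<le> 1" and C: "C \<in> E_hat N"
  shows "scale_hat N (t, C) = C"
proof -
  let ?m = "Emb_path_metric N"
  interpret C: Metric_space "completion_points ?m" "completion_dist ?m"
    by (rule Metric_space_completion)
  have C': "C \<in> completion_points ?m" and "\<And>i. snd (pi_hat C $ i) = 0"
    using C by (auto simp: E_hat_eq line_tuples0_def)
  then have "pi_hat C = scale_lines 0 (pi_hat C)"
    by (simp add: scale_lines_def vec_eq_iff prod_eq_iff)
  then have "pos_norm (pi_hat C) = 0"
    by (simp add: pos_norm_def)
  then have "completion_dist ?m (scale_hat N (t, C)) C \<le> 0"
    using scale_hat_dist[of t 1 C N C] t C' by (simp add: scale_hat_1)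
  then show ?thesis
    using C.nonneg[of "scale_hat N (t, C)" C] C' scale_hat_in[OF t C'] by (simp add: C.zero)
qed

lemma continuous_map_scale_hat:
  fixes N :: "'n::finite itself"
  defines "X \<equiv> mtopology_of (Emb_hat N)"
  shows "continuous_map (prod_topology (top_of_set {0..1}) X) X (scale_hat N)"
proof -
  let ?m = "Emb_path_metric N"
  interpret C: Metric_space "completion_points ?m" "completion_dist ?m"
    by (rule Metric_space_completion)
  have X: "X = C.mtopology"
    by (simp add: X_def Emb_hat_def mtopology_of_def)
  have "\<exists>U. openin (prod_topology (top_of_set {0..1}) X) U \<and> (s, C) \<in> U
      \<and> (\<forall>q\<in>U. scale_hat N q \<in> C.mball (scale_hat N (s, C)) e)"
    if s: "0 \<le> s" "s \<le> 1" and C: "C \<in> completion_points ?m" and "e > 0" for s C e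
  proof (intro exI conjI ballI)
    \<comment> \<open>The time term and the distance from \<open>C\<close> to \<open>D\<close> each
      get \<open>e / 2\<close>; adding 1 keeps the denominator positive when the speed at
      \<open>C\<close> is 0.\<close>
    define r where "r = e / (2 * (pos_norm (pi_hat C) + 1))"
    have pos: "pos_norm (pi_hat C) + 1 > 0"
      using pos_norm_nonneg[of "pi_hat C"] by linarith
    then have r: "r > 0"
      using \<open>e > 0\<close> by (simp add: r_def)
    have re: "r * (pos_norm (pi_hat C) + 1) = e / 2"
      using pos unfolding r_def
      by (metis divide_divide_eq_left less_irrefl mult.commute nonzero_mult_div_cancel_right
          times_divide_eq_left)
    let ?U = "({0..1} \<inter> ball s r) \<times> C.mball C (e/2)"
    show "openin (prod_topology (top_of_set {0..1}) X) ?U"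
      by (simp add: openin_prod_Times_iff X openin_open_Int)
    show "(s, C) \<in> ?U"
      using s C r \<open>e > 0\<close> by simp
    fix q assume "q \<in> ?U"
    then obtain t D where q: "q = (t, D)" and t: "0 \<le> t" "t \<le> 1" "\<bar>s - t\<bar> < r"
      and D: "D \<in> completion_points ?m" "completion_dist ?m C D < e/2"
      by (auto simp: dist_real_def)
    have "\<bar>s - t\<bar> * pos_norm (pi_hat C) \<le> r * (pos_norm (pi_hat C) + 1)"
      using t(3) by (intro mult_mono) auto
    then have "completion_dist ?m (scale_hat N (s, C)) (scale_hat N (t, D)) < e"
      using scale_hat_dist[OF s t(1,2) C D(1)] D(2) re by linarith
    then show "scale_hat N q \<in> C.mball (scale_hat N (s, C)) e"
      using q s t C D by (simp add: scale_hat_in)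
  qed
  then show ?thesis
    unfolding X[symmetric] by (subst X, subst C.continuous_map_to_metric) (auto simp: X)
qed

theorem corollary7p4:
  "mtopology_of (Emb_hat TYPE('n::finite)) homotopy_equivalent_space
     subtopology (mtopology_of (Emb_hat TYPE('n))) (E_hat TYPE('n))"
proof (rule deformation_retraction_imp_homotopy_equivalent_space)
  let ?N = "TYPE('n)" and ?X = "mtopology_of (Emb_hat TYPE('n))"
  have top: "mspace (Emb_hat ?N) = completion_points (Emb_path_metric ?N)"
    by (simp add: Emb_hat_def)
  have cont: "continuous_map ?X ?X (\<lambda>C. scale_hat ?N (0, C))"
    by (rule continuous_map_compose[OF _ continuous_map_scale_hat, unfolded o_def])
       (simp add: continuous_map_pairedI)
  then show "retraction_maps ?X (subtopology ?X (E_hat ?N)) (\<lambda>C. scale_hat ?N (0, C)) id"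
    by (auto simp: retraction_maps_def continuous_map_in_subtopology top scale_hat_0_in_E_hat
        scale_hat_fixes_E_hat continuous_map_from_subtopology)
  \<comment> \<open>\<open>scale_hat\<close> is itself the homotopy, running from the retraction at
    time 0 to the identity at time 1.\<close>
  show "homotopic_with (\<lambda>_. True) ?X ?X (id \<circ> (\<lambda>C. scale_hat ?N (0, C))) id"
    using continuous_map_scale_hat[of ?N]
    by (subst homotopic_with) (auto simp: top scale_hat_1)
qed

end
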